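(* Let $P$ be a $d$-dimensional CL-polytope with $d\leq 7$. Then $|P\cap\mathbb{Z}^d|\leq 3^d$.
   Context: A $d$-dimensional lattice polytope is a full-dimensional convex polytope $P\subset\mathbb{Z}^d\otimes_{\mathbb{Z}}\mathbb{Q}$ with vertices in $\mathbb{Z}^d$. The Ehrhart polynomial $L_P$ is the degree-$d$ polynomial with $L_P(m)=|mP\cap\mathbb{Z}^d|$ for all integers $m\geq 0$, regarded as a polynomial over $\mathbb{C}$. A lattice polytope $P$ is a CL-polytope if every root $z\in\mathbb{C}$ of $L_P$ satisfies $\operatorname{Re}(z)=-1/2$. *)

theory Defs
  imports "HOL-Analysis.Analysis" "HOL-Computational_Algebra.Polynomial"
begin

definition integer_points :: "(real ^ 'n) set" where
  "integer_points = {x. \<forall>i. x $ i \<in> \<int>}"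

definition lattice_polytope :: "(real ^ 'n) set \<Rightarrow> bool" where
  "lattice_polytope P \<longleftrightarrow>
     polytope P \<and> aff_dim P = int CARD('n) \<and> {v. v extreme_point_of P} \<subseteq> integer_points"

text \<open>
  The relation ``\<open>L\<close> is the Ehrhart polynomial of \<open>P\<close>''. For \<open>m = 0\<close> the dilate is \<open>{0}\<close>.
\<close>
definition is_Ehrhart_polynomial :: "(real ^ 'n) set \<Rightarrow> complex poly \<Rightarrow> bool" where
  "is_Ehrhart_polynomial P L \<longleftrightarrow>
     degree L = CARD('n) \<and>
     (\<forall>m::nat. poly L (of_nat m) = of_nat (card ((\<lambda>x. real m *\<^sub>R x) ` P \<inter> integer_points)))"

definition CL_polytope :: "(real ^ 'n) set \<Rightarrow> bool" where
  "CL_polytope P \<longleftrightarrow>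
     lattice_polytope P \<and>
     (\<exists>L. is_Ehrhart_polynomial P L \<and> (\<forall>z. poly L z = 0 \<longrightarrow> Re z = - 1 / 2))"

text \<open>
  The two lemmas below justify the encodings: the polynomial in \<^const>\<open>CL_polytope\<close> is unique, and
  no \<^const>\<open>card\<close> in \<^const>\<open>is_Ehrhart_polynomial\<close> has the default value of an infinite set.
\<close>
lemma is_Ehrhart_polynomial_unique:
  assumes "is_Ehrhart_polynomial P L" and "is_Ehrhart_polynomial P L'"
  shows "L = L'"
proof (rule ccontr)
  assume "L \<noteq> L'"
  then have "finite {z. poly (L - L') z = 0}"
    by (intro poly_roots_finite) auto
  moreover have "range (of_nat :: nat \<Rightarrow> complex) \<subseteq> {z. poly (L - L') z = 0}"
    using assms by (auto simp: is_Ehrhart_polynomial_def)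
  ultimately have "finite (range (of_nat :: nat \<Rightarrow> complex))"
    by (rule rev_finite_subset)
  then show False
    using infinite_UNIV_nat by (simp add: finite_image_iff inj_of_nat)
qed

lemma finite_dilate_Int_integer_points:
  fixes P :: "(real ^ 'n) set"
  assumes "lattice_polytope P"
  shows "finite ((\<lambda>x. real m *\<^sub>R x) ` P \<inter> integer_points)"
proof -
  have "bounded ((\<lambda>x. real m *\<^sub>R x) ` P)"
    using assms by (intro bounded_scaling polytope_imp_bounded) (simp add: lattice_polytope_def)
  then obtain B where B: "\<And>x. x \<in> (\<lambda>x. real m *\<^sub>R x) ` P \<Longrightarrow> norm x \<le> B"
    unfolding bounded_iff by blast
  let ?I = "{k \<in> \<int>. \<bar>k\<bar> \<le> B}"
  have "((\<lambda>x. real m *\<^sub>R x) ` P \<inter> integer_points)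
          \<subseteq> (\<lambda>f. \<chi> i. f i) ` (UNIV \<rightarrow>\<^sub>E ?I)"
  proof
    fix x assume x: "x \<in> (\<lambda>x. real m *\<^sub>R x) ` P \<inter> integer_points"
    have "\<bar>x $ i\<bar> \<le> B" for i
      using B[of x] x component_le_norm_cart[of x i] by fastforce
    then have "($) x \<in> UNIV \<rightarrow>\<^sub>E ?I"
      using x by (auto simp: integer_points_def)
    moreover have "x = (\<chi> i. x $ i)"
      by simp
    ultimately show "x \<in> (\<lambda>f. \<chi> i. f i) ` (UNIV \<rightarrow>\<^sub>E ?I)"
      by blast
  qed
  moreover have "finite ?I"
    by (rule finite_abs_int_segment)
  ultimately show ?thesis
    by (meson finite_PiE finite_UNIV finite_imageI finite_subset finite)
qed

end

theory Submission
  imports Defs "HOL-Computational_Algebra.Fundamental_Theorem_Algebra"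
begin

text \<open>
  A root on the critical line, \<open>z = - 1/2 + i t\<close>, satisfies
  \<open>|1 - z| = |3/2 - i t| \<le> 3 |1/2 - i t| = 3 |0 - z|\<close>. Multiplying over all \<open>d\<close> roots
  of the Ehrhart polynomial gives \<open>|L(1)| \<le> 3^d |L(0)| = 3^d\<close>, in every dimension \<open>d\<close>.
\<close>

text \<open>Induction on the degree splits off one linear factor at a time, each costing at most a
  factor \<open>c\<close>. The leading coefficient scales both sides equally, so \<open>p\<close>
  need not be monic; the zero polynomial falls under the base case.\<close>

lemma norm_poly_le_of_roots:
  fixes p :: "complex poly"
  assumes "\<And>z. poly p z = 0 \<Longrightarrow> norm (a - z) \<le> c * norm (b - z)"
  shows "norm (poly p a) \<le> c ^ degree p * norm (poly p b)"
  using assms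
proof (induction "degree p" arbitrary: p)
  case 0
  then obtain k where "p = [:k:]"
    by (metis degree_eq_zeroE)
  then show ?case
    by simp
next
  case (Suc n)
  then have "\<not> constant (poly p)"
    by (simp add: constant_degree)
  then obtain z where z: "poly p z = 0"
    using fundamental_theorem_of_algebra by blast
  then obtain q where p: "p = [:- z, 1:] * q"
    by (auto simp: poly_eq_0_iff_dvd dvd_def)
  with Suc.hyps(2) have "q \<noteq> 0"
    by auto
  then have deg: "degree p = Suc (degree q)"
    unfolding p by (subst degree_mult_eq) auto
  have IH: "norm (poly q a) \<le> c ^ degree q * norm (poly q b)"
    using Suc.hyps deg Suc.prems by (simp add: p)
  have "norm (poly p a) = norm (a - z) * norm (poly q a)"
    by (simp only: p poly_mult norm_mult) simp
  also have "\<dots> \<le> (c * norm (b - z)) * (c ^ degree q * norm (poly q b))"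
    \<comment> \<open>No sign of \<open>c\<close> is assumed: the root \<open>z\<close> itself gives
      \<open>0 \<le> norm (a - z) \<le> c * norm (b - z)\<close>, the nonnegativity that
      \<open>mult_mono\<close> needs.\<close>
    using Suc.prems[OF z] IH order_trans[OF norm_ge_zero Suc.prems[OF z]]
    by (intro mult_mono) auto
  also have "\<dots> = c ^ degree p * norm (poly p b)"
    unfolding deg by (simp only: p poly_mult norm_mult) simp
  finally show ?case .
qed

text \<open>For z = -1/2 + i t the squares are 9/4 + t^2 and 9/4 + 9 t^2, with equality at t = 0.
  The form \<open>0 - z\<close> matches \<open>b - z\<close> with \<open>b = 0\<close>.\<close>

lemma norm_one_minus_le_critical_line:
  assumes "Re z = - 1 / 2"
  shows "norm (1 - z) \<le> 3 * norm (0 - z)"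
proof -
  have "(norm (1 - z))\<^sup>2 \<le> (3 * norm (0 - z))\<^sup>2"
    using assms by (simp add: cmod_power2 power_mult_distrib) (simp add: power2_eq_square)
  then show ?thesis
    by (rule power2_le_imp_le) simp
qed

text \<open>The dilate by 0 collapses a nonempty \<open>P\<close> to the origin; for empty
  \<open>P\<close> the count would be 0.\<close>

lemma poly_Ehrhart_0:
  fixes P :: "(real ^ 'n) set"
  assumes "is_Ehrhart_polynomial P L" and "P \<noteq> {}"
  shows "poly L 0 = 1"
proof -
  have "(\<lambda>x. real 0 *\<^sub>R x) ` P \<inter> integer_points = {0}"
    using \<open>P \<noteq> {}\<close> by (auto simp: integer_points_def)
  moreover have "poly L (of_nat 0) =
      of_nat (card ((\<lambda>x. real 0 *\<^sub>R x) ` P \<inter> integer_points))"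
    using assms(1) unfolding is_Ehrhart_polynomial_def by blast
  ultimately show ?thesis
    by simp
qed

lemma poly_Ehrhart_1:
  assumes "is_Ehrhart_polynomial P L"
  shows "poly L 1 = of_nat (card (P \<inter> integer_points))"
  using assms unfolding is_Ehrhart_polynomial_def
  by (auto dest: spec[of _ 1])

theorem corollary1p6:
  fixes P :: "(real ^ 'n) set"
  assumes "CL_polytope P" and "CARD('n) \<le> 7"
  shows "card (P \<inter> integer_points) \<le> 3 ^ CARD('n)"
proof -
  obtain L where L: "is_Ehrhart_polynomial P L"
    and roots: "\<And>z. poly L z = 0 \<Longrightarrow> Re z = - 1 / 2"
    using assms(1) by (auto simp: CL_polytope_def)
  \<comment> \<open>The empty set has \<open>aff_dim\<close> -1, whereas \<open>aff_dim P\<close> is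
    a cardinality.\<close>
  have "P \<noteq> {}"
    using assms(1) by (auto simp: CL_polytope_def lattice_polytope_def)
  have "norm (poly L 1) \<le> 3 ^ degree L * norm (poly L 0)"
    by (intro norm_poly_le_of_roots norm_one_minus_le_critical_line roots)
  also have "degree L = CARD('n)"
    using L by (simp add: is_Ehrhart_polynomial_def)
  finally have "real (card (P \<inter> integer_points)) \<le> 3 ^ CARD('n)"
    by (simp add: poly_Ehrhart_0[OF L \<open>P \<noteq> {}\<close>] poly_Ehrhart_1[OF L])
  also have "\<dots> = real (3 ^ CARD('n))"
    by simp
  finally show ?thesis
    by (simp only: of_nat_le_iff)
qed

end
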